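(* Let $k\ge1$ be an integer and let $q\in\mathbb{C}_{k-1}[z,\bar z]$. Then the polynomial $p(z,\bar z)\equiv z^k-q(z,\bar z)$ has at most $k^2$ roots, i.e., the set $\{z\in\mathbb{C}:z^k-q(z,\bar z)=0\}$ has at most $k^2$ elements.
   Context: $\mathbb{C}_{k-1}[z,\bar z]$ denotes the space of complex polynomials in $z$ and $\bar z$ ($z$ a single complex variable) of total degree at most $k-1$, i.e., the span of $\bar z^iz^j$ with $i+j\le k-1$. *)

theory Defs
  imports Complex_Main
begin

text \<open>
  The space of complex polynomials in \<open>z\<close> and its conjugate of total degree at most \<open>d\<close>, as
  functions of \<open>z\<close>. Nothing is lost by passing to functions: the monomials \<open>cnj z ^ i * z ^ j\<close>
  are linearly independent over the complex numbers as functions on the plane.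
\<close>
definition conj_polys :: "nat \<Rightarrow> (complex \<Rightarrow> complex) set" where
  "conj_polys d =
    {q. \<exists>c :: nat \<Rightarrow> nat \<Rightarrow> complex. \<forall>z. q z = (\<Sum>i\<le>d. \<Sum>j\<le>d - i. c i j * cnj z ^ i * z ^ j)}"

end

theory Submission
  imports Defs "HOL-Computational_Algebra.Polynomial" "HOL-Library.Function_Algebras"
begin

text \<open>
  Let \<open>S\<close> be a finite set of roots. On \<open>S\<close> the equation \<open>z ^ k = q z\<close> and its complex conjugate
  rewrite \<open>z ^ k\<close> and \<open>cnj z ^ k\<close> into polynomials of smaller total degree, so every polynomial in
  \<open>z\<close> and \<open>cnj z\<close> agrees on \<open>S\<close> with a linear combination of the \<open>k\<^sup>2\<close> monomials
  \<open>cnj z ^ i * z ^ j\<close> with \<open>i, j < k\<close>. By interpolation these monomials span all functions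
  on \<open>S\<close>, a space of dimension \<open>card S\<close>.
\<close>

interpretation cfun: vector_space "\<lambda>(c::'b::field) (f::'a \<Rightarrow> 'b) x. c * f x"
  by unfold_locales (simp_all add: fun_eq_iff algebra_simps)

lemma sum_fun_apply: "(\<Sum>i\<in>I. f i) x = (\<Sum>i\<in>I. f i x)"
  by (induction I rule: infinite_finite_induct) simp_all

text \<open>Evaluating a vanishing combination of indicators at \<open>a\<close> isolates the
  coefficient of \<open>a\<close>. So they are independent, and the exchange bound applies.\<close>

lemma card_le_of_indicators_in_span:
  fixes B :: "('a \<Rightarrow> 'b::field) set"
  assumes "finite B" and "finite S"
    and "\<And>a. a \<in> S \<Longrightarrow> (\<lambda>x. if x = a then 1 else 0) \<in> cfun.span B"
  shows "card S \<le> card B"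
proof -
  define e :: "'a \<Rightarrow> 'a \<Rightarrow> 'b" where "e = (\<lambda>a x. if x = a then 1 else 0)"
  have inj: "inj_on e S"
    by (rule inj_onI) (metis e_def zero_neq_one)
  have "cfun.independent (e ` S)"
  proof -
    have "u a = 0" if "(\<Sum>a\<in>S. (\<lambda>x. u a * e a x)) = 0" and "a \<in> S" for u a
    proof -
      have "0 = (\<Sum>b\<in>S. u b * e b a)"
        using fun_cong[OF that(1), of a] by (simp add: sum_fun_apply)
      also have "\<dots> = (\<Sum>b\<in>S. if b = a then u b else 0)"
        by (rule sum.cong) (auto simp: e_def)
      also have "\<dots> = u a"
        using that(2) assms(2) by simp
      finally show ?thesis by simp
    qed
    then have "u (e a) = 0" if "(\<Sum>f\<in>e ` S. (\<lambda>x. u f * f x)) = 0" and "a \<in> S" for u a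
      using that by (simp add: sum.reindex[OF inj])
    then show ?thesis
      using assms(2) by (auto simp: cfun.dependent_finite)
  qed
  moreover have "e ` S \<subseteq> cfun.span B"
    using assms(3) by (auto simp: e_def)
  ultimately have "card (e ` S) \<le> card B"
    using cfun.independent_span_bound[OF assms(1)] by blast
  then show ?thesis
    by (simp add: card_image[OF inj])
qed

text \<open>Lagrange interpolation: the product of the linear factors at the other points,
  normalised at \<open>a\<close>.\<close>

lemma indicator_eq_poly_on_finite:
  fixes S :: "'a::field set"
  assumes "finite S" and "a \<in> S"
  obtains p where "(\<lambda>x. if x = a then 1 else 0) = (\<lambda>x. if x \<in> S then poly p x else 0)"
proof
  let ?p = "\<Prod>b\<in>S - {a}. [:- b, 1:]"
  have "poly ?p a \<noteq> 0"
    using assms by (auto simp: poly_prod)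
  moreover have "poly ?p x = 0" if "x \<in> S" "x \<noteq> a" for x
    using that assms by (auto simp: poly_prod)
  ultimately show "(\<lambda>x. if x = a then 1 else 0) =
      (\<lambda>x. if x \<in> S then poly (smult (1 / poly ?p a) ?p) x else 0)"
    using assms(2) by (auto simp: fun_eq_iff)
qed

lemma card_finite_roots_le:
  assumes k: "k \<ge> 1" and q: "q \<in> conj_polys (k - 1)"
    and fin: "finite S" and roots: "\<And>z. z \<in> S \<Longrightarrow> z ^ k = q z"
  shows "card S \<le> k\<^sup>2"
proof -
  obtain c where c: "q z = (\<Sum>a\<le>k-1. \<Sum>b\<le>k-1-a. c a b * cnj z ^ a * z ^ b)" for z
    using q unfolding conj_polys_def by blast
  \<comment> \<open>Cutting the monomials off to 0 outside \<open>S\<close> turns relations that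
    hold only at the roots into equalities of functions.\<close>
  define m :: "nat \<Rightarrow> nat \<Rightarrow> complex \<Rightarrow> complex" where
    "m = (\<lambda>i j z. if z \<in> S then cnj z ^ i * z ^ j else 0)"
  define B where "B = case_prod m ` ({..<k} \<times> {..<k})"
  \<comment> \<open>Since \<open>k \<ge> 1\<close>, the index ranges describe exactly the pairs with
    \<open>a + b < k\<close>.\<close>
  have comb: "(\<Sum>a\<le>k-1. \<Sum>b\<le>k-1-a. (\<lambda>z. d a b * m (f a b) (g a b) z)) \<in> cfun.span B"
    if "\<And>a b. a + b < k \<Longrightarrow> m (f a b) (g a b) \<in> cfun.span B" for d f g
    using that k by (intro cfun.span_sum cfun.span_scale) auto
  \<comment> \<open>Induction on the total degree: trading a factor of degree \<open>k\<close> for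
    terms of degree \<open>a + b < k\<close> lowers it strictly.\<close>
  have m_span: "m i j \<in> cfun.span B" for i j
  proof (induction "i + j" arbitrary: i j rule: less_induct)
    case less
    consider "i < k" "j < k" | "k \<le> j" | "k \<le> i" by linarith
    then show ?case
    proof cases
      case 1
      then show ?thesis
        by (auto simp: B_def intro!: cfun.span_base)
    next
      case 2
      have "m i j = (\<Sum>a\<le>k-1. \<Sum>b\<le>k-1-a. (\<lambda>z. c a b * m (i + a) (j - k + b) z))"
      proof
        fix z
        have "cnj z ^ i * z ^ j = cnj z ^ i * z ^ (j - k) * q z" if "z \<in> S"
          using 2 roots[OF that] by (metis mult.assoc power_add le_add_diff_inverse2)
        then show "m i j z = (\<Sum>a\<le>k-1. \<Sum>b\<le>k-1-a. (\<lambda>z. c a b * m (i + a) (j - k + b) z)) z"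
          by (simp add: m_def sum_fun_apply c sum_distrib_left power_add mult_ac)
      qed
      then show ?thesis
        using 2 by (simp only:) (intro comb less.hyps, linarith)
    next
      case 3
      \<comment> \<open>Conjugating \<open>q\<close> swaps the two exponents, so here
        \<open>b\<close> goes to the power of \<open>cnj z\<close> and \<open>a\<close> to that of
        \<open>z\<close>.\<close>
      have "m i j = (\<Sum>a\<le>k-1. \<Sum>b\<le>k-1-a. (\<lambda>z. cnj (c a b) * m (i - k + b) (j + a) z))"
      proof
        fix z
        have "cnj z ^ i * z ^ j = cnj z ^ (i - k) * z ^ j * cnj (q z)" if "z \<in> S"
        proof -
          have "cnj z ^ i = cnj z ^ (i - k) * cnj z ^ k"
            using 3 by (simp flip: power_add)
          then show ?thesis
            by (simp flip: roots[OF that])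
        qed
        then show "m i j z = (\<Sum>a\<le>k-1. \<Sum>b\<le>k-1-a. (\<lambda>z. cnj (c a b) * m (i - k + b) (j + a) z)) z"
          by (simp add: m_def sum_fun_apply c sum_distrib_left power_add mult_ac)
      qed
      then show ?thesis
        using 3 by (simp only:) (intro comb less.hyps, linarith)
    qed
  qed
  have "(\<lambda>x. if x = a then 1 else 0) \<in> cfun.span B" if a: "a \<in> S" for a
  proof -
    obtain p where "(\<lambda>x. if x = a then 1 else 0) = (\<lambda>x. if x \<in> S then poly p x else 0)"
      using indicator_eq_poly_on_finite[OF fin a] by blast
    \<comment> \<open>The interpolant involves powers of \<open>z\<close> alone, possibly beyond
      \<open>k\<close>; \<open>m_span\<close> covers every exponent.\<close>
    also have "\<dots> = (\<Sum>n\<le>degree p. (\<lambda>x. coeff p n * m 0 n x))"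
      by (auto simp: fun_eq_iff sum_fun_apply m_def poly_altdef)
    also have "\<dots> \<in> cfun.span B"
      by (intro cfun.span_sum cfun.span_scale m_span)
    finally show ?thesis .
  qed
  then have "card S \<le> card B"
    using fin by (intro card_le_of_indicators_in_span) (auto simp: B_def)
  also have "\<dots> \<le> card ({..<k} \<times> {..<k})"
    unfolding B_def by (intro card_image_le) simp
  finally show ?thesis
    by (simp add: power2_eq_square)
qed

theorem proposition4p4:
  fixes k :: nat and q :: "complex \<Rightarrow> complex"
  assumes "k \<ge> 1"
    and "q \<in> conj_polys (k - 1)"
  shows "finite {z :: complex. z ^ k - q z = 0} \<and> card {z :: complex. z ^ k - q z = 0} \<le> k\<^sup>2"
\<comment> \<open>Interpolation requires finite sets of roots; as the bound is the same for all of
  them, it also excludes infinitely many roots.\<close>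
proof (rule finite_if_finite_subsets_card_bdd)
  fix S
  assume "S \<subseteq> {z. z ^ k - q z = 0}" and "finite S"
  then show "card S \<le> k\<^sup>2"
    using card_finite_roots_le[OF assms] by auto
qed

end
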